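(* For a fixed cyclic group $A$, bijective cocycle data $(G,A,\rho,\pi)$ are, up to isomorphism, in one-to-one correspondence with $T$-structures $(A,T)$ on $A$; the correspondence assigns to $(G,A,\rho,\pi)$ the map $T(x)=\rho(\pi^{-1}(x))(x)$.
   Context: A bijective cocycle datum is a quadruple $(G,A,\rho,\pi)$ where $G$ is a group, $A$ is a $G$-module (abelian group) with the $G$-action given by a homomorphism $\rho:G\to\mathrm{Aut}(A)$, and $\pi:G\to A$ is a bijective 1-cocycle, i.e. a bijection with $\pi(g_1g_2)=\rho(g_2)^{-1}\pi(g_1)+\pi(g_2)$ for all $g_1,g_2\in G$. For fixed $A$, two data $(G,A,\rho,\pi)$ and $(G',A,\rho',\pi')$ are isomorphic if there is a group isomorphism $\varphi:G\to G'$ with $\rho'\circ\varphi=\rho$ and $\pi'\circ\varphi=\pi$. A $T$-structure is a pair $(A,T)$ of an abelian group $A$ and a bijective map $T:A\to A$ such that $T(kx)=kT^k(x)$ for all $x\in A$ and $k\in\mathbb{Z}$ (here $T^k$ is the $k$-th iterate of $T$, with $T^{-1}$ the inverse map for negative $k$). For any bijective cocycle datum the map $T(x)=\rho(\pi^{-1}(x))(x)$ is a $T$-structure on $A$. *)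

theory Defs
  imports "HOL-Algebra.Bij" "HOL-Algebra.Elementary_Groups"
begin

text \<open>
  All groups, including the abelian group \<open>A\<close>, are written multiplicatively, as in
  HOL-Algebra: the sum \<open>x + y\<close> in \<open>A\<close> is \<open>x \<otimes>\<^bsub>A\<^esub> y\<close>, and the multiple \<open>k x\<close> is \<open>x [^]\<^bsub>A\<^esub> k\<close>.
  The group \<open>Aut(A)\<close> is \<^const>\<open>AutoGroup\<close>, with composition as its product, so a
  homomorphism into it is a left action.
\<close>

definition bijective_cocycle_datum ::
  "('g, 'c) monoid_scheme \<Rightarrow> ('a, 'b) monoid_scheme \<Rightarrow> ('g \<Rightarrow> 'a \<Rightarrow> 'a) \<Rightarrow> ('g \<Rightarrow> 'a) \<Rightarrow> bool"
  where
  "bijective_cocycle_datum G A \<rho> \<pi> \<longleftrightarrow>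
     group G \<and> comm_group A \<and>
     \<rho> \<in> hom G (AutoGroup A) \<and>
     bij_betw \<pi> (carrier G) (carrier A) \<and>
     (\<forall>g\<^sub>1\<in>carrier G. \<forall>g\<^sub>2\<in>carrier G.
        \<pi> (g\<^sub>1 \<otimes>\<^bsub>G\<^esub> g\<^sub>2) = (inv\<^bsub>AutoGroup A\<^esub> (\<rho> g\<^sub>2)) (\<pi> g\<^sub>1) \<otimes>\<^bsub>A\<^esub> \<pi> g\<^sub>2)"

text \<open>
  The group \<open>A\<close> is fixed, so a datum is represented by the triple \<open>(G, \<rho>, \<pi>)\<close>. HOL functions
  are total, and the values of \<open>\<rho>\<close> and \<open>\<pi>\<close> outside \<open>carrier G\<close> carry no meaning; the
  isomorphism relation ignores them.
\<close>

type_synonym ('g, 'a) cocycle_triple = "'g monoid \<times> ('g \<Rightarrow> 'a \<Rightarrow> 'a) \<times> ('g \<Rightarrow> 'a)"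

definition cocycle_data :: "('a, 'b) monoid_scheme \<Rightarrow> ('g, 'a) cocycle_triple set" where
  "cocycle_data A = {(G, \<rho>, \<pi>). bijective_cocycle_datum G A \<rho> \<pi>}"

definition cocycle_isomorphic ::
  "('g, 'a) cocycle_triple \<Rightarrow> ('h, 'a) cocycle_triple \<Rightarrow> bool" where
  "cocycle_isomorphic = (\<lambda>(G, \<rho>, \<pi>) (G', \<rho>', \<pi>').
     \<exists>\<phi> \<in> iso G G'. \<forall>g\<in>carrier G. \<rho>' (\<phi> g) = \<rho> g \<and> \<pi>' (\<phi> g) = \<pi> g)"

definition cocycle_iso_rel ::
  "('a, 'b) monoid_scheme \<Rightarrow> (('g, 'a) cocycle_triple \<times> ('g, 'a) cocycle_triple) set" where
  "cocycle_iso_rel A =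
     {(D, D'). D \<in> cocycle_data A \<and> D' \<in> cocycle_data A \<and> cocycle_isomorphic D D'}"

text \<open>
  The iterate \<open>T\<^sup>k\<close> for integer \<open>k\<close> is the power of \<open>T\<close> in the group \<^const>\<open>BijGroup\<close> of
  bijections of the carrier. Membership in \<^const>\<open>Bij\<close> fixes \<open>T\<close> to be \<open>undefined\<close> off the
  carrier, so that equality of such functions is equality of maps on \<open>A\<close>.
\<close>

definition T_structure :: "('a, 'b) monoid_scheme \<Rightarrow> ('a \<Rightarrow> 'a) \<Rightarrow> bool" where
  "T_structure A T \<longleftrightarrow>
     comm_group A \<and> T \<in> Bij (carrier A) \<and>
     (\<forall>x\<in>carrier A. \<forall>k::int.
        T (x [^]\<^bsub>A\<^esub> k) = (T [^]\<^bsub>BijGroup (carrier A)\<^esub> k) x [^]\<^bsub>A\<^esub> k)"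

definition T_map :: "('a, 'b) monoid_scheme \<Rightarrow> ('g, 'a) cocycle_triple \<Rightarrow> 'a \<Rightarrow> 'a" where
  "T_map A = (\<lambda>(G, \<rho>, \<pi>). \<lambda>x\<in>carrier A. \<rho> (inv_into (carrier G) \<pi> x) x)"

end

theory Submission
  imports Defs
begin

text \<open>
  In additive notation: a bijective cocycle datum on \<open>A\<close> amounts, up to isomorphism, to a family
  of automorphisms \<open>\<gamma>\<^sub>y = \<rho>(\<pi>\<^sup>-\<^sup>1 y)\<close> of \<open>A\<close> with \<open>\<gamma>\<^bsub>u + y\<^esub> = \<gamma>\<^bsub>\<gamma>\<^sub>y(u)\<^esub> \<gamma>\<^sub>y\<close>
  (\<open>gamma_function_transported_action\<close>, \<open>cocycle_isomorphic_iff_transported_action\<close>); conversely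
  every such family defines a group law on \<open>A\<close> for which the identity map is a bijective cocycle
  (\<open>bijective_cocycle_datum_twisted_group\<close>). The map \<open>T\<close> of the datum is the diagonal
  \<open>x \<mapsto> \<gamma>\<^sub>x(x)\<close>.

  Everything rests on the identity \<open>\<gamma>\<^bsub>kx\<^esub>(x) = T\<^sup>k(x)\<close> (\<open>gamma_int_pow\<close>), which holds in every
  abelian group. Applying \<open>\<gamma>\<^bsub>kx\<^esub>\<close> to \<open>k x\<close>, it says that \<open>T\<close> is a \<open>T\<close>-structure. For \<open>A\<close> cyclic
  with generator \<open>a\<close>, every element is some \<open>k a\<close> and an automorphism is determined by its value
  at \<open>a\<close>; the identity at \<open>x = a\<close> therefore shows that \<open>T\<close> determines \<open>\<gamma>\<close>, and so the datum up
  to isomorphism.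

  Given a \<open>T\<close>-structure on the cyclic group, the same identity prescribes \<open>\<gamma>\<close>: let
  \<open>\<gamma>\<^bsub>ka\<^esub>\<close> be the endomorphism sending \<open>a\<close> to \<open>T\<^sup>k(a)\<close>. It is well defined because \<open>T\<^sup>k(a)\<close>
  depends only on \<open>k a\<close> (\<open>iter_generator_cong\<close>), it is an automorphism because \<open>T\<close> and its
  inverse preserve generators (\<open>is_generator_T\<close>, \<open>is_generator_T_preimage\<close>), and the law for
  \<open>\<gamma>\<close> follows from the iterated form \<open>T\<^sup>j(m x) = m T\<^bsup>jm\<^esup>(x)\<close> of the defining equation
  (\<open>iter_int_pow\<close>).
\<close>

section \<open>Automorphisms and integer iterates as functions\<close>

lemma BijGroup_mult_apply:
  assumes "f \<in> Bij S" "g \<in> Bij S" "x \<in> S"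
  shows "(f \<otimes>\<^bsub>BijGroup S\<^esub> g) x = f (g x)"
  using assms by (simp add: BijGroup_def compose_eq)

lemma Bij_closed: "f \<in> Bij S \<Longrightarrow> x \<in> S \<Longrightarrow> f x \<in> S"
  using Bij_imp_funcset by blast

lemma Bij_eqD: "f \<in> Bij S \<Longrightarrow> f x = f y \<Longrightarrow> x \<in> S \<Longrightarrow> y \<in> S \<Longrightarrow> x = y"
  by (auto simp: Bij_def bij_betw_def inj_on_def)

abbreviation int_iterate :: "'a set \<Rightarrow> ('a \<Rightarrow> 'a) \<Rightarrow> int \<Rightarrow> 'a \<Rightarrow> 'a" where
  "int_iterate S T k \<equiv> T [^]\<^bsub>BijGroup S\<^esub> k"

lemma int_iterate_Bij: "T \<in> Bij S \<Longrightarrow> int_iterate S T k \<in> Bij S"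
  using group.int_pow_closed[OF group_BijGroup, of T S k] by (simp add: BijGroup_def)

lemma int_iterate_closed: "T \<in> Bij S \<Longrightarrow> x \<in> S \<Longrightarrow> int_iterate S T k x \<in> S"
  by (rule Bij_closed[OF int_iterate_Bij])

lemma BijGroup_one_apply [simp]: "x \<in> S \<Longrightarrow> \<one>\<^bsub>BijGroup S\<^esub> x = x"
  by (simp add: BijGroup_def)

lemma int_iterate_1: "T \<in> Bij S \<Longrightarrow> int_iterate S T 1 = T"
  using group.int_pow_1[OF group_BijGroup, of T S] by (simp add: BijGroup_def)

lemma int_iterate_add:
  assumes "T \<in> Bij S" "x \<in> S"
  shows "int_iterate S T (j + k) x = int_iterate S T j (int_iterate S T k x)"
proof -
  have "int_iterate S T (j + k) = int_iterate S T j \<otimes>\<^bsub>BijGroup S\<^esub> int_iterate S T k"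
    using group.int_pow_mult[OF group_BijGroup, of T S j k] assms by (simp add: BijGroup_def)
  then show ?thesis
    using assms by (simp only: BijGroup_mult_apply int_iterate_Bij)
qed

lemma int_iterate_Suc:
  assumes "T \<in> Bij S" "x \<in> S"
  shows "int_iterate S T (k + 1) x = T (int_iterate S T k x)"
  using int_iterate_add[OF assms, of 1 k] int_iterate_1[OF assms(1)] by (simp add: add.commute)

text \<open>
  A two-sided recursion along a bijection has only one solution: forwards by applying \<open>T\<close>, and
  backwards by cancelling it. Identities between iterates with possibly negative exponents are
  thereby reduced to a single recursion step.
\<close>

lemma int_iterate_unique:
  fixes f :: "int \<Rightarrow> 'a"
  assumes T: "T \<in> Bij S" and "f 0 = x" and S: "\<And>k. f k \<in> S"
    and step: "\<And>k. f (k + 1) = T (f k)"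
  shows "f k = int_iterate S T k x"
proof (induction k rule: int_induct[where k = 0])
  have x: "x \<in> S" using S[of 0] assms(2) by simp
  case base
  then show ?case using assms(2) x by simp
next
  have x: "x \<in> S" using S[of 0] assms(2) by simp
  case (step1 i)
  then show ?case using step int_iterate_Suc[OF T x] by simp
next
  have x: "x \<in> S" using S[of 0] assms(2) by simp
  case (step2 i)
  have "T (f (i - 1)) = T (int_iterate S T (i - 1) x)"
    using step[of "i - 1"] int_iterate_Suc[OF T x, of "i - 1"] step2(2) by simp
  then show ?case
    using T S x by (blast intro: Bij_eqD int_iterate_closed)
qed

context group
begin

lemma autoD:
  assumes "f \<in> auto G"
  shows "f \<in> hom G G" "f \<in> Bij (carrier G)"
  using assms by (auto simp: auto_def)

lemma auto_closed: "f \<in> auto G \<Longrightarrow> x \<in> carrier G \<Longrightarrow> f x \<in> carrier G"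
  using autoD(2) Bij_closed by metis

lemma auto_mult:
  "f \<in> auto G \<Longrightarrow> x \<in> carrier G \<Longrightarrow> y \<in> carrier G \<Longrightarrow> f (x \<otimes> y) = f x \<otimes> f y"
  using autoD(1) hom_mult by metis

lemma auto_inj:
  "f \<in> auto G \<Longrightarrow> f x = f y \<Longrightarrow> x \<in> carrier G \<Longrightarrow> y \<in> carrier G \<Longrightarrow> x = y"
  using autoD(2) Bij_eqD by metis

lemma auto_int_pow:
  "f \<in> auto G \<Longrightarrow> x \<in> carrier G \<Longrightarrow> f (x [^] (k::int)) = f x [^] k"
  using hom_int_pow[of f G G x k] autoD(1) is_group by blast

lemma auto_inv:
  "f \<in> auto G \<Longrightarrow> x \<in> carrier G \<Longrightarrow> f (inv x) = inv (f x)"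
  using auto_int_pow[of f x "-1"] auto_closed[of f x] by (simp add: int_pow_neg)

lemma auto_eqI:
  assumes "f \<in> auto G" "g \<in> auto G" "\<And>x. x \<in> carrier G \<Longrightarrow> f x = g x"
  shows "f = g"
  using assms autoD(2) Bij_imp_extensional by (metis extensionalityI)

lemma carrier_AutoGroup: "carrier (AutoGroup G) = auto G"
  by (simp add: AutoGroup_def)

lemma AutoGroup_mult_apply:
  assumes "f \<in> auto G" "g \<in> auto G" "x \<in> carrier G"
  shows "(f \<otimes>\<^bsub>AutoGroup G\<^esub> g) x = f (g x)"
  using BijGroup_mult_apply[of f "carrier G" g x] assms autoD(2) by (simp add: AutoGroup_def)

lemma AutoGroup_inv:
  assumes "f \<in> auto G"
  shows "inv\<^bsub>AutoGroup G\<^esub> f \<in> auto G"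
    and "x \<in> carrier G \<Longrightarrow> (inv\<^bsub>AutoGroup G\<^esub> f) (f x) = x"
    and "x \<in> carrier G \<Longrightarrow> f ((inv\<^bsub>AutoGroup G\<^esub> f) x) = x"
proof -
  interpret Aut: group "AutoGroup G" by (rule AutoGroup)
  have f: "f \<in> carrier (AutoGroup G)" using assms by (simp add: carrier_AutoGroup)
  show g: "inv\<^bsub>AutoGroup G\<^esub> f \<in> auto G"
    using Aut.inv_closed[OF f] by (simp add: carrier_AutoGroup)
  have one: "x \<in> carrier G \<Longrightarrow> \<one>\<^bsub>AutoGroup G\<^esub> x = x"
    by (simp add: AutoGroup_def BijGroup_def)
  show "(inv\<^bsub>AutoGroup G\<^esub> f) (f x) = x" if "x \<in> carrier G"
    using AutoGroup_mult_apply[OF g assms that] Aut.l_inv[OF f] one[OF that] by simp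
  show "f ((inv\<^bsub>AutoGroup G\<^esub> f) x) = x" if "x \<in> carrier G"
    using AutoGroup_mult_apply[OF assms g that] Aut.r_inv[OF f] one[OF that] by simp
qed

end

section \<open>The gamma function of a bijective cocycle\<close>

text \<open>
  Transporting the group structure of \<open>G\<close> to \<open>A\<close> along \<open>\<pi>\<close> leaves only the family
  \<open>\<gamma> y = \<rho> (\<pi>\<^sup>-\<^sup>1 y)\<close> of automorphisms of \<open>A\<close> as data. In additive notation the new product
  satisfies \<open>\<gamma>\<^sub>y(u) \<circ> y = u + y\<close>, by the cocycle law, so the homomorphism law for \<open>\<rho>\<close> becomes
  \<open>\<gamma>\<^bsub>u + y\<^esub> = \<gamma>\<^bsub>\<gamma>\<^sub>y(u)\<^esub> \<gamma>\<^sub>y\<close>, in which neither \<open>G\<close> nor inverses appear. Such families are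
  known as gamma functions in the theory of braces.
\<close>

locale gamma_function = comm_group A for A (structure) +
  fixes \<gamma> :: "'a \<Rightarrow> 'a \<Rightarrow> 'a"
  assumes gamma_auto: "y \<in> carrier A \<Longrightarrow> \<gamma> y \<in> auto A"
    and gamma_mult: "\<lbrakk>u \<in> carrier A; y \<in> carrier A; v \<in> carrier A\<rbrakk> \<Longrightarrow>
          \<gamma> (u \<otimes> y) v = \<gamma> (\<gamma> y u) (\<gamma> y v)"
begin

definition diagonal :: "'a \<Rightarrow> 'a" where
  "diagonal = (\<lambda>x\<in>carrier A. \<gamma> x x)"

lemma gamma_closed: "y \<in> carrier A \<Longrightarrow> x \<in> carrier A \<Longrightarrow> \<gamma> y x \<in> carrier A"
  by (rule auto_closed[OF gamma_auto])

lemma gamma_one: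
  assumes "v \<in> carrier A"
  shows "\<gamma> \<one> v = v"
proof -
  have "\<gamma> \<one> \<one> = \<one>"
    using auto_int_pow[OF gamma_auto, of \<one> \<one> 0] by simp
  then have "\<gamma> \<one> v = \<gamma> \<one> (\<gamma> \<one> v)"
    using gamma_mult[of \<one> \<one> v] assms by simp
  then show ?thesis
    using auto_inj[OF gamma_auto, of \<one> v "\<gamma> \<one> v"] assms by (simp add: gamma_closed)
qed

text \<open>
  The inverse of \<open>x\<close> for the transported product is \<open>-T(x)\<close>, where \<open>T\<close> is the diagonal; since
  inversion is an involution, \<open>T\<close> is a bijection.
\<close>

lemma diagonal_inv_diagonal:
  assumes "x \<in> carrier A"
  shows "diagonal (inv (diagonal x)) = inv x"
proof -
  have "\<gamma> (inv (\<gamma> x x)) (\<gamma> x v) = v" if "v \<in> carrier A" for v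
    using gamma_mult[of "inv x" x v] gamma_one[OF that] assms that
    by (simp add: auto_inv[OF gamma_auto])
  from this[of "inv x"] show ?thesis
    using assms by (simp add: diagonal_def gamma_closed auto_inv[OF gamma_auto])
qed

lemma diagonal_Bij: "diagonal \<in> Bij (carrier A)"
proof -
  have closed: "diagonal x \<in> carrier A" if "x \<in> carrier A" for x
    using that by (simp add: diagonal_def gamma_closed)
  have "bij_betw diagonal (carrier A) (carrier A)"
  proof (rule bij_betw_byWitness[where f' = "\<lambda>y. inv (diagonal (inv y))"])
    show "\<forall>x\<in>carrier A. inv (diagonal (inv (diagonal x))) = x"
      by (simp add: diagonal_inv_diagonal)
    show "\<forall>y\<in>carrier A. diagonal (inv (diagonal (inv y))) = y"
      by (simp add: diagonal_inv_diagonal)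
  qed (use closed in auto)
  then show ?thesis by (simp add: Bij_def diagonal_def)
qed

text \<open>
  With \<open>y = k x\<close> and \<open>u = x\<close>, the gamma law gives \<open>\<gamma>\<^bsub>(k + 1)x\<^esub>(x) = \<gamma>\<^sub>z(z) = T(z)\<close> for
  \<open>z = \<gamma>\<^bsub>kx\<^esub>(x)\<close>, so \<open>k \<mapsto> \<gamma>\<^bsub>kx\<^esub>(x)\<close> is the orbit of \<open>x\<close> under \<open>T\<close>. This one identity yields the
  law of \<open>T\<close>-structures, and it recovers \<open>\<gamma>\<close> from \<open>T\<close> when \<open>A\<close> is cyclic.
\<close>

lemma gamma_int_pow:
  assumes x: "x \<in> carrier A"
  shows "\<gamma> (x [^] (k::int)) x = int_iterate (carrier A) diagonal k x"
proof (rule int_iterate_unique[OF diagonal_Bij, of "\<lambda>k. \<gamma> (x [^] (k::int)) x"])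
  show "\<gamma> (x [^] (0::int)) x = x"
    using x by (simp add: gamma_one)
  fix k :: int
  show "\<gamma> (x [^] k) x \<in> carrier A"
    using x by (simp add: gamma_closed)
  have "x [^] (k + 1) = x \<otimes> x [^] k"
    using x int_pow_mult[of x 1 k] by (simp add: add.commute)
  then show "\<gamma> (x [^] (k + 1)) x = diagonal (\<gamma> (x [^] k) x)"
    using x gamma_mult[of x "x [^] k" x] by (simp add: diagonal_def gamma_closed)
qed

lemma T_structure_diagonal: "T_structure A diagonal"
  unfolding T_structure_def
proof (intro conjI ballI allI)
  show "comm_group A" by (rule comm_group_axioms)
  show "diagonal \<in> Bij (carrier A)" by (rule diagonal_Bij)
  fix x and k :: int
  assume x: "x \<in> carrier A"
  have "diagonal (x [^] k) = \<gamma> (x [^] k) x [^] k"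
    using x by (simp add: diagonal_def auto_int_pow[OF gamma_auto])
  then show "diagonal (x [^] k) = int_iterate (carrier A) diagonal k x [^] k"
    using x by (simp add: gamma_int_pow)
qed

text \<open>
  The law \<open>x \<circ> y = \<gamma>\<^sub>y\<^sup>-\<^sup>1(x) + y\<close> is forced by asking the identity map to satisfy the cocycle
  equation; the gamma law is what makes it associative.
\<close>

definition twisted_group :: "'a monoid" where
  "twisted_group = \<lparr>carrier = carrier A, mult = (\<lambda>x y. (inv\<^bsub>AutoGroup A\<^esub> \<gamma> y) x \<otimes> y), one = \<one>\<rparr>"

lemma gamma_twisted_mult:
  assumes "x \<in> carrier A" "y \<in> carrier A"
  shows "\<gamma> (x \<otimes>\<^bsub>twisted_group\<^esub> y) = \<gamma> x \<otimes>\<^bsub>AutoGroup A\<^esub> \<gamma> y"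
proof (rule auto_eqI)
  note y = gamma_auto[OF assms(2)]
  let ?u = "(inv\<^bsub>AutoGroup A\<^esub> \<gamma> y) x"
  have u: "?u \<in> carrier A" "\<gamma> y ?u = x"
    using AutoGroup_inv[OF y] assms by (auto intro: auto_closed)
  then show "\<gamma> (x \<otimes>\<^bsub>twisted_group\<^esub> y) \<in> auto A"
    using assms by (simp add: twisted_group_def gamma_auto)
  show "\<gamma> x \<otimes>\<^bsub>AutoGroup A\<^esub> \<gamma> y \<in> auto A"
    using monoid.m_closed[OF group.is_monoid[OF AutoGroup]] gamma_auto assms
    by (simp add: carrier_AutoGroup)
  show "\<gamma> (x \<otimes>\<^bsub>twisted_group\<^esub> y) v = (\<gamma> x \<otimes>\<^bsub>AutoGroup A\<^esub> \<gamma> y) v" if "v \<in> carrier A" for v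
    using u gamma_mult[of ?u y v] assms that
    by (simp add: twisted_group_def AutoGroup_mult_apply gamma_auto)
qed

lemma group_twisted_group: "group twisted_group"
proof (rule groupI)
  interpret Aut: group "AutoGroup A" by (rule AutoGroup)
  let ?s = "\<lambda>y. inv\<^bsub>AutoGroup A\<^esub> \<gamma> y"
  have s_auto: "?s y \<in> auto A" if "y \<in> carrier A" for y
    using AutoGroup_inv(1) gamma_auto that by blast
  have s_closed: "?s y x \<in> carrier A" if "x \<in> carrier A" "y \<in> carrier A" for x y
    using s_auto auto_closed that by blast
  show "x \<otimes>\<^bsub>twisted_group\<^esub> y \<in> carrier twisted_group"
    if "x \<in> carrier twisted_group" "y \<in> carrier twisted_group" for x y
    using that by (simp add: twisted_group_def s_closed)
  show "\<one>\<^bsub>twisted_group\<^esub> \<in> carrier twisted_group"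
    by (simp add: twisted_group_def)
  show "x \<otimes>\<^bsub>twisted_group\<^esub> y \<otimes>\<^bsub>twisted_group\<^esub> z = x \<otimes>\<^bsub>twisted_group\<^esub> (y \<otimes>\<^bsub>twisted_group\<^esub> z)"
    if "x \<in> carrier twisted_group" "y \<in> carrier twisted_group" "z \<in> carrier twisted_group" for x y z
  proof -
    have xyz: "x \<in> carrier A" "y \<in> carrier A" "z \<in> carrier A"
      using that by (auto simp: twisted_group_def)
    have "?s (y \<otimes>\<^bsub>twisted_group\<^esub> z) = ?s z \<otimes>\<^bsub>AutoGroup A\<^esub> ?s y"
      using xyz gamma_auto by (simp add: gamma_twisted_mult Aut.inv_mult_group carrier_AutoGroup)
    then have "?s (?s z y \<otimes> z) x = ?s z (?s y x)"
      using xyz by (simp add: twisted_group_def AutoGroup_mult_apply s_auto)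
    then show ?thesis
      using xyz by (simp add: twisted_group_def auto_mult[OF s_auto] s_closed m_assoc)
  qed
  show "\<one>\<^bsub>twisted_group\<^esub> \<otimes>\<^bsub>twisted_group\<^esub> x = x" if "x \<in> carrier twisted_group" for x
    using that auto_int_pow[OF s_auto, of x \<one> 0] by (simp add: twisted_group_def)
  show "\<exists>y\<in>carrier twisted_group. y \<otimes>\<^bsub>twisted_group\<^esub> x = \<one>\<^bsub>twisted_group\<^esub>"
    if "x \<in> carrier twisted_group" for x
  proof -
    have x: "x \<in> carrier A" using that by (simp add: twisted_group_def)
    have "?s x (\<gamma> x (inv x)) = inv x"
      using AutoGroup_inv(2)[OF gamma_auto] x by simp
    then show ?thesis
      using x by (intro bexI[of _ "\<gamma> x (inv x)"]) (simp_all add: twisted_group_def gamma_closed)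
  qed
qed

lemma bijective_cocycle_datum_twisted_group:
  "bijective_cocycle_datum twisted_group A \<gamma> (\<lambda>x. x)"
  unfolding bijective_cocycle_datum_def
proof (intro conjI ballI)
  show "group twisted_group" by (rule group_twisted_group)
  show "comm_group A" by (rule comm_group_axioms)
  show "\<gamma> \<in> hom twisted_group (AutoGroup A)"
    using gamma_auto gamma_twisted_mult
    by (auto simp: hom_def carrier_AutoGroup twisted_group_def)
qed (auto simp: twisted_group_def bij_betw_def)

lemma T_map_twisted_group: "T_map A (twisted_group, \<gamma>, \<lambda>x. x) = diagonal"
proof -
  have "inv_into (carrier A) (\<lambda>x. x) x = x" if "x \<in> carrier A" for x
    using inv_into_f_f[of "\<lambda>x. x" "carrier A" x] that by simp
  then show ?thesis
    by (auto simp: T_map_def diagonal_def twisted_group_def)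
qed

end

definition transported_action ::
  "('g, 'c) monoid_scheme \<Rightarrow> ('g \<Rightarrow> 'a \<Rightarrow> 'a) \<Rightarrow> ('g \<Rightarrow> 'a) \<Rightarrow> 'a \<Rightarrow> 'a \<Rightarrow> 'a" where
  "transported_action G \<rho> \<pi> x = \<rho> (inv_into (carrier G) \<pi> x)"

lemma transported_action_cocycle:
  assumes "bijective_cocycle_datum G A \<rho> \<pi>" "g \<in> carrier G"
  shows "transported_action G \<rho> \<pi> (\<pi> g) = \<rho> g"
proof -
  have "bij_betw \<pi> (carrier G) (carrier A)"
    using assms by (simp add: bijective_cocycle_datum_def)
  from bij_betw_inv_into_left[OF this assms(2)] show ?thesis
    by (simp add: transported_action_def)
qed

lemma gamma_function_transported_action:
  assumes D: "bijective_cocycle_datum G A \<rho> \<pi>"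
  shows "gamma_function A (transported_action G \<rho> \<pi>)"
proof -
  interpret A: comm_group A using D by (simp add: bijective_cocycle_datum_def)
  interpret G: group G using D by (simp add: bijective_cocycle_datum_def)
  have bij: "bij_betw \<pi> (carrier G) (carrier A)" and hom: "\<rho> \<in> hom G (AutoGroup A)"
    and coc: "\<And>g h. g \<in> carrier G \<Longrightarrow> h \<in> carrier G \<Longrightarrow>
        \<pi> (g \<otimes>\<^bsub>G\<^esub> h) = (inv\<^bsub>AutoGroup A\<^esub> (\<rho> h)) (\<pi> g) \<otimes>\<^bsub>A\<^esub> \<pi> h"
    using D by (auto simp: bijective_cocycle_datum_def)
  have rho: "\<rho> g \<in> auto A" if "g \<in> carrier G" for g
    using hom_in_carrier[OF hom that] by (simp add: A.carrier_AutoGroup)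
  have surj: "\<exists>g\<in>carrier G. \<pi> g = x" if "x \<in> carrier A" for x
    using that unfolding bij_betw_imp_surj_on[OF bij, symmetric] by blast
  let ?\<gamma> = "transported_action G \<rho> \<pi>"
  show ?thesis
  proof
    fix y assume "y \<in> carrier A"
    then obtain g where "g \<in> carrier G" "\<pi> g = y" using surj by blast
    then show "?\<gamma> y \<in> auto A"
      using transported_action_cocycle[OF D] rho by metis
  next
    fix u y v assume uyv: "u \<in> carrier A" "y \<in> carrier A" "v \<in> carrier A"
    obtain g where g: "g \<in> carrier G" "\<pi> g = y" using surj uyv by blast
    have "\<rho> g u \<in> carrier A" using A.auto_closed rho g uyv by blast
    then obtain h where h: "h \<in> carrier G" "\<pi> h = \<rho> g u" using surj by blast
    have "\<pi> (h \<otimes>\<^bsub>G\<^esub> g) = u \<otimes>\<^bsub>A\<^esub> y"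
      using coc[OF h(1) g(1)] A.AutoGroup_inv(2)[OF rho[OF g(1)] uyv(1)] g h by simp
    then have "?\<gamma> (u \<otimes>\<^bsub>A\<^esub> y) = \<rho> h \<otimes>\<^bsub>AutoGroup A\<^esub> \<rho> g"
      using transported_action_cocycle[OF D, of "h \<otimes>\<^bsub>G\<^esub> g"] g h hom_mult[OF hom] by simp
    moreover have "?\<gamma> y = \<rho> g" "?\<gamma> (\<rho> g u) = \<rho> h"
      using transported_action_cocycle[OF D g(1)] transported_action_cocycle[OF D h(1)] g h
      by simp_all
    ultimately show "?\<gamma> (u \<otimes>\<^bsub>A\<^esub> y) v = ?\<gamma> (?\<gamma> y u) (?\<gamma> y v)"
      using uyv g h rho by (simp add: A.AutoGroup_mult_apply)
  qed
qed

lemma T_map_eq_diagonal: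
  assumes "bijective_cocycle_datum G A \<rho> \<pi>"
  shows "T_map A (G, \<rho>, \<pi>) = gamma_function.diagonal A (transported_action G \<rho> \<pi>)"
  using gamma_function.diagonal_def[OF gamma_function_transported_action[OF assms]]
  by (simp add: T_map_def transported_action_def)

section \<open>Isomorphism of data\<close>

text \<open>
  A datum is determined up to isomorphism by its transported action: the only candidate for an
  isomorphism is \<open>\<pi>'\<^sup>-\<^sup>1 \<circ> \<pi>\<close>, and the cocycle law writes both products in terms of this action.
\<close>

lemma cocycle_isomorphic_iff_transported_action:
  assumes D: "bijective_cocycle_datum G A \<rho> \<pi>" and D': "bijective_cocycle_datum G' A \<rho>' \<pi>'"
  shows "cocycle_isomorphic (G, \<rho>, \<pi>) (G', \<rho>', \<pi>') \<longleftrightarrow>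
    (\<forall>x\<in>carrier A. transported_action G \<rho> \<pi> x = transported_action G' \<rho>' \<pi>' x)"
    (is "_ \<longleftrightarrow> (\<forall>x\<in>_. ?\<gamma> x = ?\<gamma>' x)")
proof
  assume "cocycle_isomorphic (G, \<rho>, \<pi>) (G', \<rho>', \<pi>')"
  then obtain \<phi> where "\<phi> \<in> iso G G'"
    and eq: "\<And>g. g \<in> carrier G \<Longrightarrow> \<rho>' (\<phi> g) = \<rho> g \<and> \<pi>' (\<phi> g) = \<pi> g"
    unfolding cocycle_isomorphic_def by blast
  then have closed: "\<And>g. g \<in> carrier G \<Longrightarrow> \<phi> g \<in> carrier G'"
    by (auto simp: iso_def hom_def)
  show "\<forall>x\<in>carrier A. ?\<gamma> x = ?\<gamma>' x"
  proof
    fix x assume "x \<in> carrier A"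
    moreover have "carrier A = \<pi> ` carrier G"
      using D by (simp add: bijective_cocycle_datum_def bij_betw_def)
    ultimately have "x \<in> \<pi> ` carrier G" by simp
    then obtain g where g: "g \<in> carrier G" "\<pi> g = x" by blast
    then show "?\<gamma> x = ?\<gamma>' x"
      using transported_action_cocycle[OF D g(1)]
        transported_action_cocycle[OF D' closed[OF g(1)]] eq[OF g(1)] by simp
  qed
next
  assume eq: "\<forall>x\<in>carrier A. ?\<gamma> x = ?\<gamma>' x"
  interpret G: group G using D by (simp add: bijective_cocycle_datum_def)
  interpret G': group G' using D' by (simp add: bijective_cocycle_datum_def)
  have bij: "bij_betw \<pi> (carrier G) (carrier A)"
    and coc: "\<And>g h. g \<in> carrier G \<Longrightarrow> h \<in> carrier G \<Longrightarrow>
        \<pi> (g \<otimes>\<^bsub>G\<^esub> h) = (inv\<^bsub>AutoGroup A\<^esub> (\<rho> h)) (\<pi> g) \<otimes>\<^bsub>A\<^esub> \<pi> h"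
    using D by (auto simp: bijective_cocycle_datum_def)
  have bij': "bij_betw \<pi>' (carrier G') (carrier A)"
    and coc': "\<And>g h. g \<in> carrier G' \<Longrightarrow> h \<in> carrier G' \<Longrightarrow>
        \<pi>' (g \<otimes>\<^bsub>G'\<^esub> h) = (inv\<^bsub>AutoGroup A\<^esub> (\<rho>' h)) (\<pi>' g) \<otimes>\<^bsub>A\<^esub> \<pi>' h"
    using D' by (auto simp: bijective_cocycle_datum_def)
  define \<phi> where "\<phi> = inv_into (carrier G') \<pi>' \<circ> \<pi>"
  have bij_phi: "bij_betw \<phi> (carrier G) (carrier G')"
    unfolding \<phi>_def by (rule bij_betw_trans[OF bij bij_betw_inv_into[OF bij']])
  then have closed: "\<And>g. g \<in> carrier G \<Longrightarrow> \<phi> g \<in> carrier G'"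
    by (auto simp: bij_betw_def)
  have pi: "\<pi>' (\<phi> g) = \<pi> g" if "g \<in> carrier G" for g
    using bij_betw_inv_into_right[OF bij'] bij that by (auto simp: \<phi>_def bij_betw_def)
  have rho: "\<rho>' (\<phi> g) = \<rho> g" if "g \<in> carrier G" for g
  proof -
    have "\<pi> g \<in> carrier A" using bij that by (auto simp: bij_betw_def)
    then show ?thesis
      using transported_action_cocycle[OF D that] transported_action_cocycle[OF D' closed[OF that]]
        pi[OF that] eq by simp
  qed
  have "\<phi> (g \<otimes>\<^bsub>G\<^esub> h) = \<phi> g \<otimes>\<^bsub>G'\<^esub> \<phi> h" if "g \<in> carrier G" "h \<in> carrier G" for g h
  proof (rule inj_onD[OF bij_betw_imp_inj_on[OF bij']])
    show "\<pi>' (\<phi> (g \<otimes>\<^bsub>G\<^esub> h)) = \<pi>' (\<phi> g \<otimes>\<^bsub>G'\<^esub> \<phi> h)"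
      using that by (simp add: pi rho coc coc' closed)
  qed (use that closed in auto)
  then have "\<phi> \<in> iso G G'"
    using bij_phi closed by (auto simp: iso_def hom_def)
  then show "cocycle_isomorphic (G, \<rho>, \<pi>) (G', \<rho>', \<pi>')"
    using pi rho by (auto simp: cocycle_isomorphic_def)
qed

section \<open>Cyclic groups\<close>

context comm_group
begin

definition is_generator :: "'a \<Rightarrow> bool" where
  "is_generator a \<longleftrightarrow> a \<in> carrier G \<and> (\<forall>x\<in>carrier G. \<exists>k::int. x = a [^] k)"

lemma is_generatorD: "is_generator a \<Longrightarrow> a \<in> carrier G"
  by (simp add: is_generator_def)

lemma generatorE:
  assumes "is_generator a" "x \<in> carrier G"
  obtains k :: int where "x = a [^] k"
  using assms by (auto simp: is_generator_def)

lemma is_generator_if_int_pow: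
  assumes "is_generator a" "b \<in> carrier G" "b [^] (i::int) = a"
  shows "is_generator b"
  unfolding is_generator_def
proof (intro conjI ballI)
  fix x assume "x \<in> carrier G"
  then obtain k :: int where "x = a [^] k" using generatorE assms(1) by blast
  then have "x = b [^] (i * k)" using assms by (simp add: int_pow_pow[symmetric])
  then show "\<exists>k::int. x = b [^] k" by blast
qed (rule assms)

lemma is_generator_inv:
  assumes "is_generator a"
  shows "is_generator (inv a)"
  using is_generator_if_int_pow[OF assms, of "inv a" "-1"] is_generatorD[OF assms]
  by (simp add: int_pow_neg)

text \<open>
  If \<open>m a\<close> generates, then \<open>j (m a) = a\<close> for some \<open>j\<close>, and multiplication by \<open>j\<close> is inverse to
  multiplication by \<open>m\<close> on all multiples of \<open>a\<close>.
\<close>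

lemma int_pow_auto:
  assumes a: "is_generator a" and am: "is_generator (a [^] (m::int))"
  shows "(\<lambda>x\<in>carrier G. x [^] m) \<in> auto G"
proof -
  obtain j :: int where "a = (a [^] m) [^] j"
    using generatorE[OF am is_generatorD[OF a]] .
  then have a_eq: "a [^] (m * j) = a"
    using is_generatorD[OF a] by (simp add: int_pow_pow)
  have id: "x [^] (m * j) = x" if x: "x \<in> carrier G" for x
  proof -
    obtain k :: int where k: "x = a [^] k" using generatorE[OF a x] .
    have "x [^] (m * j) = (a [^] (m * j)) [^] k"
      using k is_generatorD[OF a] by (simp add: int_pow_pow mult.commute)
    then show ?thesis using k a_eq by simp
  qed
  have "bij_betw (\<lambda>x. x [^] m) (carrier G) (carrier G)"
    by (rule bij_betw_byWitness[where f' = "\<lambda>x. x [^] j"])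
      (auto simp: int_pow_pow id mult.commute[of j m])
  then have "bij_betw (\<lambda>x\<in>carrier G. x [^] m) (carrier G) (carrier G)"
    by (subst bij_betw_cong[of _ _ "\<lambda>x. x [^] m"]) auto
  then show ?thesis
    by (auto simp: auto_def Bij_def hom_def int_pow_distrib)
qed

end

lemma gamma_function_determined_by_diagonal:
  assumes "gamma_function A \<gamma>" "gamma_function A \<gamma>'"
    and a: "comm_group.is_generator A a"
    and eq: "gamma_function.diagonal A \<gamma> = gamma_function.diagonal A \<gamma>'"
    and x: "x \<in> carrier A"
  shows "\<gamma> x = \<gamma>' x"
proof -
  interpret gamma_function A \<gamma> by (rule assms)
  interpret gamma': gamma_function A \<gamma>' by (rule assms)
  note aA = is_generatorD[OF a]
  have "\<gamma> x a = \<gamma>' x a"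
    using generatorE[OF a x] gamma_int_pow[OF aA] gamma'.gamma_int_pow[OF aA] eq by metis
  then have "\<gamma> x v = \<gamma>' x v" if v: "v \<in> carrier A" for v
    using generatorE[OF a v] auto_int_pow[OF gamma_auto[OF x] aA]
      auto_int_pow[OF gamma'.gamma_auto[OF x] aA] by metis
  then show ?thesis
    using auto_eqI gamma_auto gamma'.gamma_auto x by blast
qed

section \<open>From a T-structure to a gamma function\<close>

locale cyclic_T_structure = comm_group A for A (structure) +
  fixes T :: "'a \<Rightarrow> 'a" and a :: 'a
  assumes T: "T_structure A T" and a: "is_generator a"
begin

abbreviation iter :: "int \<Rightarrow> 'a \<Rightarrow> 'a" where
  "iter \<equiv> int_iterate (carrier A) T"

lemma T_Bij: "T \<in> Bij (carrier A)"
  using T by (simp add: T_structure_def)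

lemma T_int_pow: "x \<in> carrier A \<Longrightarrow> T (x [^] (k::int)) = iter k x [^] k"
  using T by (simp add: T_structure_def)

lemma a_closed: "a \<in> carrier A"
  by (rule is_generatorD[OF a])

lemmas iter_closed = int_iterate_closed[OF T_Bij]

text \<open>
  Along \<open>j\<close>, the right-hand side advances by \<open>m T\<^sup>m(z) = T(m z)\<close> with \<open>z = T\<^bsup>jm\<^esup>(x)\<close>, so it is
  the orbit of \<open>m x\<close>.
\<close>

lemma iter_int_pow:
  assumes "x \<in> carrier A"
  shows "iter j (x [^] (m::int)) = iter (j * m) x [^] m"
proof -
  have "iter (j * m) x [^] m = iter j (x [^] m)"
  proof (rule int_iterate_unique[OF T_Bij, of "\<lambda>j. iter (j * m) x [^] m"])
    show "iter (0 * m) x [^] m = x [^] m"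
      using assms by simp
    fix j
    show "iter (j * m) x [^] m \<in> carrier A"
      using assms by (simp add: iter_closed)
    have "iter ((j + 1) * m) x = iter m (iter (j * m) x)"
      using int_iterate_add[OF T_Bij assms, of m "j * m"] by (simp add: algebra_simps)
    then show "iter ((j + 1) * m) x [^] m = T (iter (j * m) x [^] m)"
      using assms by (simp add: T_int_pow iter_closed)
  qed
  then show ?thesis by simp
qed

text \<open>
  If \<open>n a = 0\<close>, then \<open>T(a) = T((n + 1) a) = (n + 1) T\<^bsup>n+1\<^esup>(a) = T\<^bsup>n+1\<^esup>(a)\<close>, because \<open>n\<close> kills the
  whole cyclic group; so \<open>T\<^sup>n(a) = a\<close>. Hence \<open>T\<^sup>k(a)\<close> depends only on the element \<open>k a\<close>.
\<close>

lemma iter_generator_cong: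
  assumes eq: "a [^] (k::int) = a [^] (l::int)"
  shows "iter k a = iter l a"
proof -
  define n where "n = k - l"
  have an: "a [^] n = \<one>"
    unfolding n_def using eq a_closed by (simp add: int_pow_diff)
  have kill: "x [^] n = \<one>" if x: "x \<in> carrier A" for x
  proof -
    obtain i :: int where "x = a [^] i" using generatorE[OF a x] .
    then have "x [^] n = (a [^] n) [^] i"
      using a_closed by (simp add: int_pow_pow mult.commute)
    then show ?thesis using an by simp
  qed
  have pow: "x [^] (n + 1) = x" if "x \<in> carrier A" for x
    using that kill by (simp add: int_pow_mult)
  have "T a = iter (n + 1) a"
    using T_int_pow[OF a_closed, of "n + 1"] a_closed by (simp add: pow iter_closed)
  then have "T a = T (iter n a)"
    using int_iterate_Suc[OF T_Bij a_closed] by simp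
  then have "iter n a = a"
    using Bij_eqD[OF T_Bij] a_closed iter_closed by metis
  then show ?thesis
    using int_iterate_add[OF T_Bij a_closed, of l n] by (simp add: n_def)
qed

text \<open>
  If \<open>T(x) = g\<close> is a generator, write \<open>x = j g\<close>; then \<open>g = T(j g) = j T\<^sup>j(g)\<close> is a multiple of
  \<open>j g = x\<close>, because \<open>T\<^sup>j(g)\<close> is a multiple of \<open>g\<close>.
\<close>

lemma is_generator_T_preimage:
  assumes x: "x \<in> carrier A" and g: "is_generator (T x)"
  shows "is_generator x"
proof -
  note gA = is_generatorD[OF g]
  obtain j :: int where j: "x = T x [^] j" using generatorE[OF g x] .
  obtain i :: int where i: "iter j (T x) = T x [^] i"
    using generatorE[OF g iter_closed[OF gA]] .
  have "T x = T (T x [^] j)" using j by simp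
  also have "\<dots> = (T x [^] i) [^] j" using T_int_pow[OF gA] i by simp
  also have "\<dots> = (T x [^] j) [^] i" using gA by (simp add: int_pow_pow mult.commute)
  also have "\<dots> = x [^] i" using j by simp
  finally show ?thesis using is_generator_if_int_pow[OF g x] by metis
qed

text \<open>
  The reverse direction would follow by counting the generators, but the law
  \<open>T(-x) = -T\<^sup>-\<^sup>1(x)\<close> gives it directly, as it writes \<open>T\<close> as a conjugate of its inverse.
\<close>

lemma is_generator_T:
  assumes g: "is_generator x"
  shows "is_generator (T x)"
proof -
  have x: "inv x \<in> carrier A" using is_generatorD[OF g] by simp
  define w where "w = iter (- 1) (inv x)"
  have w: "w \<in> carrier A" unfolding w_def by (rule iter_closed[OF x])
  have "T w = inv x"
    using int_iterate_Suc[OF T_Bij x, of "- 1"] x by (simp add: w_def)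
  then have "is_generator w"
    using is_generator_T_preimage[OF w] is_generator_inv[OF g] by simp
  moreover have "T x = inv w"
    using T_int_pow[OF x, of "- 1"] w x is_generatorD[OF g] by (simp add: int_pow_neg w_def)
  ultimately show ?thesis using is_generator_inv by simp
qed

lemma is_generator_iter: "is_generator (iter k a)"
proof (induction k rule: int_induct[where k = 0])
  case base
  then show ?case using a a_closed by simp
next
  case (step1 i)
  then show ?case using int_iterate_Suc[OF T_Bij a_closed] is_generator_T by simp
next
  case (step2 i)
  then show ?case
    using int_iterate_Suc[OF T_Bij a_closed, of "i - 1"]
      is_generator_T_preimage[OF iter_closed[OF a_closed]] by simp
qed

definition dlog :: "'a \<Rightarrow> int" where
  "dlog x = (SOME k. x = a [^] k)"

lemma int_pow_dlog: "x \<in> carrier A \<Longrightarrow> a [^] dlog x = x"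
  unfolding dlog_def using generatorE[OF a] by (metis (mono_tags, lifting) someI_ex)

text \<open>
  For every gamma function with diagonal \<open>T\<close>, the automorphism at \<open>k a\<close> sends \<open>a\<close> to \<open>T\<^sup>k(a)\<close>.
  The definition takes this as the prescription, the automorphism being written as a power map.
\<close>

definition induced_gamma :: "'a \<Rightarrow> 'a \<Rightarrow> 'a" where
  "induced_gamma x = (\<lambda>v\<in>carrier A. v [^] dlog (iter (dlog x) a))"

lemma induced_gamma_int_pow: "induced_gamma (a [^] (k::int)) (a [^] (j::int)) = iter k a [^] j"
proof -
  have "iter (dlog (a [^] k)) a = iter k a"
    by (rule iter_generator_cong) (simp add: int_pow_dlog a_closed)
  moreover have "a [^] (j * dlog (iter k a)) = (a [^] dlog (iter k a)) [^] j"
    using a_closed by (simp add: int_pow_pow mult.commute)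
  ultimately show ?thesis
    using a_closed by (simp add: induced_gamma_def int_pow_pow int_pow_dlog iter_closed)
qed

lemma induced_gamma_auto: "induced_gamma x \<in> auto A"
  unfolding induced_gamma_def
  by (rule int_pow_auto[OF a]) (simp add: int_pow_dlog iter_closed a_closed is_generator_iter)

lemma gamma_function_induced: "gamma_function A induced_gamma"
proof
  show "induced_gamma y \<in> auto A" for y by (rule induced_gamma_auto)
next
  fix u y v assume "u \<in> carrier A" "y \<in> carrier A" "v \<in> carrier A"
  then obtain j k i :: int where uyv: "u = a [^] j" "y = a [^] k" "v = a [^] i"
    using generatorE[OF a] by metis
  obtain m :: int where m: "iter k a = a [^] m"
    using generatorE[OF a iter_closed[OF a_closed]] .
  have "induced_gamma (u \<otimes> y) v = iter (j + k) a [^] i"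
    using uyv a_closed induced_gamma_int_pow[of "j + k" i] by (simp add: int_pow_mult)
  also have "iter (j + k) a = iter (j * m) a [^] m"
    using int_iterate_add[OF T_Bij a_closed] iter_int_pow[OF a_closed] m by simp
  also have "\<dots> [^] i = induced_gamma (a [^] (m * j)) (a [^] (m * i))"
    using a_closed by (simp add: induced_gamma_int_pow int_pow_pow iter_closed mult.commute)
  also have "\<dots> = induced_gamma (induced_gamma y u) (induced_gamma y v)"
    using a_closed uyv m by (simp add: induced_gamma_int_pow int_pow_pow)
  finally show "induced_gamma (u \<otimes> y) v = induced_gamma (induced_gamma y u) (induced_gamma y v)" .
qed

lemma diagonal_induced: "gamma_function.diagonal A induced_gamma = T"
proof (rule extensionalityI[of _ "carrier A"])
  interpret gamma_function A induced_gamma by (rule gamma_function_induced)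
  show "diagonal \<in> extensional (carrier A)" by (simp add: diagonal_def)
  show "T \<in> extensional (carrier A)" using T_Bij by (rule Bij_imp_extensional)
  fix x assume "x \<in> carrier A"
  moreover obtain k :: int where "x = a [^] k" using generatorE[OF a calculation] .
  ultimately show "diagonal x = T x"
    using a_closed by (simp add: diagonal_def induced_gamma_int_pow T_int_pow)
qed

end

section \<open>The correspondence\<close>

lemma kernel_relation_quotient:
  fixes f :: "'x \<Rightarrow> 'y"
  assumes R: "R = {(x, y). x \<in> S \<and> y \<in> S \<and> f x = f y}"
  shows "equiv S R" and "f respects R"
    and "bij_betw (\<lambda>C. the_elem (f ` C)) (S // R) (f ` S)"
proof -
  show equiv: "equiv S R"
    by (rule equivI) (auto simp: R refl_on_def sym_def trans_def)
  show resp: "f respects R"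
    by (auto simp: R congruent_def)
  have val: "the_elem (f ` (R `` {x})) = f x" if "x \<in> S" for x
  proof -
    have "f ` (R `` {x}) = {f x}" using that by (auto simp: R)
    then show ?thesis by simp
  qed
  have "inj_on (\<lambda>C. the_elem (f ` C)) (S // R)"
  proof (rule inj_onI)
    fix C D assume "C \<in> S // R" "D \<in> S // R" and eq: "the_elem (f ` C) = the_elem (f ` D)"
    then obtain x y where "x \<in> S" "y \<in> S" "C = R `` {x}" "D = R `` {y}"
      by (auto simp: quotient_def)
    moreover from this eq have "f x = f y" by (simp add: val)
    ultimately show "C = D" by (auto simp: R)
  qed
  moreover have "(\<lambda>C. the_elem (f ` C)) ` (S // R) = f ` S"
    by (simp add: quotient_def UNION_singleton_eq_range image_image val)
  ultimately show "bij_betw (\<lambda>C. the_elem (f ` C)) (S // R) (f ` S)"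
    by (simp add: bij_betw_def)
qed

lemma T_structure_T_map:
  assumes "D \<in> cocycle_data A"
  shows "T_structure A (T_map A D)"
proof -
  obtain G \<rho> \<pi> where D: "D = (G, \<rho>, \<pi>)" "bijective_cocycle_datum G A \<rho> \<pi>"
    using assms by (auto simp: cocycle_data_def)
  then show ?thesis
    using gamma_function.T_structure_diagonal[OF gamma_function_transported_action[OF D(2)]]
    by (simp add: T_map_eq_diagonal)
qed

lemma cocycle_isomorphic_iff_T_map:
  assumes A: "comm_group A" and a: "comm_group.is_generator A a"
    and "D \<in> cocycle_data A" "D' \<in> cocycle_data A"
  shows "cocycle_isomorphic D D' \<longleftrightarrow> T_map A D = T_map A D'"
proof -
  obtain G \<rho> \<pi> where D: "D = (G, \<rho>, \<pi>)" "bijective_cocycle_datum G A \<rho> \<pi>"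
    using assms by (auto simp: cocycle_data_def)
  obtain G' \<rho>' \<pi>' where D': "D' = (G', \<rho>', \<pi>')" "bijective_cocycle_datum G' A \<rho>' \<pi>'"
    using assms by (auto simp: cocycle_data_def)
  note \<gamma> = gamma_function_transported_action[OF D(2)]
  note \<gamma>' = gamma_function_transported_action[OF D'(2)]
  let ?\<gamma> = "transported_action G \<rho> \<pi>" and ?\<gamma>' = "transported_action G' \<rho>' \<pi>'"
  have "(\<forall>x\<in>carrier A. ?\<gamma> x = ?\<gamma>' x) \<longleftrightarrow>
      gamma_function.diagonal A ?\<gamma> = gamma_function.diagonal A ?\<gamma>'"
  proof
    assume "\<forall>x\<in>carrier A. ?\<gamma> x = ?\<gamma>' x"
    then show "gamma_function.diagonal A ?\<gamma> = gamma_function.diagonal A ?\<gamma>'"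
      unfolding gamma_function.diagonal_def[OF \<gamma>] gamma_function.diagonal_def[OF \<gamma>']
      by (intro restrict_ext) simp
  qed (use gamma_function_determined_by_diagonal[OF \<gamma> \<gamma>' a] in blast)
  then show ?thesis
    using D D' by (simp add: cocycle_isomorphic_iff_transported_action T_map_eq_diagonal)
qed

lemma ex_cocycle_datum_T_map:
  fixes A :: "('a, 'm) monoid_scheme"
  assumes A: "comm_group A" and a: "comm_group.is_generator A a" and T: "T_structure A T"
  shows "\<exists>D \<in> (cocycle_data A :: ('a, 'a) cocycle_triple set). T_map A D = T"
proof -
  interpret comm_group A by (rule A)
  interpret cyclic_T_structure A T a by unfold_locales (rule T, rule a)
  interpret gamma_function A induced_gamma by (rule gamma_function_induced)
  show ?thesis
    using bijective_cocycle_datum_twisted_group T_map_twisted_group diagonal_induced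
    by (intro bexI[of _ "(twisted_group, induced_gamma, \<lambda>x. x)"]) (simp_all add: cocycle_data_def)
qed

theorem theoremA7:
  fixes A :: "('a, 'm) monoid_scheme"
  assumes "group A" and "cyclic_group A"
  shows
    "(\<forall>D \<in> (cocycle_data A :: ('g, 'a) cocycle_triple set). T_structure A (T_map A D)) \<and>
     (\<forall>D \<in> (cocycle_data A :: ('g, 'a) cocycle_triple set).
      \<forall>D' \<in> (cocycle_data A :: ('h, 'a) cocycle_triple set).
        cocycle_isomorphic D D' \<longleftrightarrow> T_map A D = T_map A D') \<and>
     equiv (cocycle_data A :: ('a, 'a) cocycle_triple set) (cocycle_iso_rel A) \<and>
     T_map A respects (cocycle_iso_rel A :: (('a, 'a) cocycle_triple \<times> ('a, 'a) cocycle_triple) set) \<and>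
     bij_betw (\<lambda>C. the_elem (T_map A ` C))
       ((cocycle_data A :: ('a, 'a) cocycle_triple set) // cocycle_iso_rel A)
       {T. T_structure A T}"
proof -
  have A: "comm_group A"
    using assms by (rule group.cyclic_imp_abelian_group)
  obtain a where a: "comm_group.is_generator A a"
    using assms unfolding group.cyclic_group[OF assms(1)] comm_group.is_generator_def[OF A]
    by blast
  note iff = cocycle_isomorphic_iff_T_map[OF A a]
  have rel: "(cocycle_iso_rel A :: (('a, 'a) cocycle_triple \<times> ('a, 'a) cocycle_triple) set) =
      {(D, D'). D \<in> cocycle_data A \<and> D' \<in> cocycle_data A \<and> T_map A D = T_map A D'}"
    by (auto simp: cocycle_iso_rel_def iff)
  have image: "T_map A ` (cocycle_data A :: ('a, 'a) cocycle_triple set) = {T. T_structure A T}"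
  proof (intro Set.set_eqI iffI)
    fix T assume "T \<in> {T. T_structure A T}"
    then show "T \<in> T_map A ` (cocycle_data A :: ('a, 'a) cocycle_triple set)"
      using ex_cocycle_datum_T_map[OF A a] by blast
  qed (use T_structure_T_map in blast)
  show ?thesis
    using kernel_relation_quotient[OF rel] unfolding image
    by (intro conjI ballI iff T_structure_T_map)
qed

end
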